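(* Let $n\in\mathbb{N}$, $n\geq 2$, and let $A\in M_n(\mathbb{C})$. Then the rank of the derivative of $\mathbf{c}$ at $A$ is equal to the degree of the minimal polynomial of $A$.
   Context: $M_n(\mathbb{C})\equiv\mathbb{C}^{n^2}$ is the set of all $n\times n$ complex matrices. The holomorphic map $\mathbf{c}:M_n(\mathbb{C})\to\mathbb{C}^n$ is $\mathbf{c}(W)=(c_1(W),\dots,c_n(W))$, where $t^n+\sum_{k=1}^n(-1)^k c_k(W)t^{n-k}$ is the characteristic polynomial of $W$. Its derivative at $A$ is the complex linear map $\mathbf{c}'(A):M_n(\mathbb{C})\to\mathbb{C}^n$. *)

theory Defs
  imports "HOL-Analysis.Analysis" "HOL-Computational_Algebra.Polynomial"
begin

definition char_polynomial :: "complex^'n^'n \<Rightarrow> complex poly" where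
  "char_polynomial W = det (\<chi> i j. (if i = j then [:0, 1:] else 0) - [:W $ i $ j:])"

text \<open>The number \<open>c\<^sub>k(W)\<close> for which the characteristic polynomial of \<open>W\<close> is
  \<open>t\<^sup>n + (\<Sum>k=1..n. (-1)\<^sup>k c\<^sub>k(W) t\<^bsup>n-k\<^esup>)\<close>.\<close>

definition char_coeff :: "nat \<Rightarrow> complex^'n^'n \<Rightarrow> complex" where
  "char_coeff k W = (-1) ^ k * coeff (char_polynomial W) (CARD('n) - k)"

text \<open>The target \<open>\<complex>\<^sup>n\<close> of the map \<open>c\<close> is indexed by the same type as the rows of the
  matrices. The linear order on that type identifies it with \<open>{1..n}\<close>: the \<open>k\<close>-th smallest
  index \<open>i\<close> is the one with \<open>card {..i} = k\<close>, and the component there is \<open>c\<^sub>k\<close>.\<close>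

definition char_coeffs :: "complex^('n::{finite,linorder})^('n::{finite,linorder}) \<Rightarrow> complex^('n::{finite,linorder})" where
  "char_coeffs W = (\<chi> i. char_coeff (card {..i}) W)"

text \<open>\<open>vec.dim\<close> is the dimension over the field of scalars, here over \<open>\<complex>\<close> (whereas
  \<open>dim\<close> would be the dimension over \<open>\<real>\<close>).\<close>

definition map_rank :: "(complex^'n^'n \<Rightarrow> complex^'m) \<Rightarrow> nat" where
  "map_rank L = vec.dim (range L)"

text \<open>Matrix powers are iterates of \<open>**\<close>, because \<open>^\<close> and \<open>*\<close> on type \<open>vec\<close> are
  componentwise.\<close>

definition poly_matrix :: "complex poly \<Rightarrow> complex^'n^'n \<Rightarrow> complex^'n^'n" where
  "poly_matrix p A =
     (\<Sum>i\<le>degree p. map_matrix (\<lambda>x. coeff p i * x) (((\<lambda>B. A ** B) ^^ i) (mat 1)))"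

definition min_polynomial :: "complex^'n^'n \<Rightarrow> complex poly" where
  "min_polynomial A =
     (THE p. lead_coeff p = 1 \<and> poly_matrix p A = 0 \<and>
             (\<forall>q. lead_coeff q = 1 \<and> poly_matrix q A = 0 \<longrightarrow> degree p \<le> degree q))"

subsection \<open>Complex differentiability of the coefficient map\<close>

text \<open>\<open>frechet_derivative\<close> is the derivative over \<open>\<real>\<close>. The following shows that for
  \<open>char_coeffs\<close> it exists and is complex linear, so it is the complex derivative.\<close>

definition cdiff_at :: "(complex^'n^'n \<Rightarrow> complex) \<Rightarrow> complex^'n^'n \<Rightarrow> bool" where
  "cdiff_at f A \<longleftrightarrow> (\<exists>D. (f has_derivative D) (at A) \<and>
      (\<forall>a H. D (map_matrix (\<lambda>x. a * x) H) = a * D H))"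

lemma cdiff_at_const: "cdiff_at (\<lambda>W. a) A"
  unfolding cdiff_at_def by (rule exI[of _ "\<lambda>H. 0"]) auto

lemma cdiff_at_entry: "cdiff_at (\<lambda>W. W $ i $ j) A"
  unfolding cdiff_at_def
  by (rule exI[of _ "\<lambda>H. H $ i $ j"])
     (auto intro!: bounded_linear_imp_has_derivative bounded_linear_compose[OF bounded_linear_vec_nth]
        bounded_linear_vec_nth)

lemma cdiff_at_add:
  assumes "cdiff_at f A" "cdiff_at g A"
  shows "cdiff_at (\<lambda>W. f W + g W) A"
proof -
  obtain D E where "(f has_derivative D) (at A)" "(g has_derivative E) (at A)"
    "\<And>a H. D (map_matrix (\<lambda>x. a * x) H) = a * D H" "\<And>a H. E (map_matrix (\<lambda>x. a * x) H) = a * E H"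
    using assms unfolding cdiff_at_def by blast
  then show ?thesis unfolding cdiff_at_def
    by (intro exI[of _ "\<lambda>H. D H + E H"]) (auto intro: has_derivative_add simp: algebra_simps)
qed

lemma cdiff_at_mult:
  assumes "cdiff_at f A" "cdiff_at g A"
  shows "cdiff_at (\<lambda>W. f W * g W) A"
proof -
  obtain D E where "(f has_derivative D) (at A)" "(g has_derivative E) (at A)"
    "\<And>a H. D (map_matrix (\<lambda>x. a * x) H) = a * D H" "\<And>a H. E (map_matrix (\<lambda>x. a * x) H) = a * E H"
    using assms unfolding cdiff_at_def by blast
  then show ?thesis unfolding cdiff_at_def
    by (intro exI[of _ "\<lambda>H. f A * E H + D H * g A"] conjI has_derivative_mult)
       (auto simp: algebra_simps)
qed

lemma cdiff_at_sum:
  assumes "\<And>x. x \<in> S \<Longrightarrow> cdiff_at (f x) A"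
  shows "cdiff_at (\<lambda>W. \<Sum>x\<in>S. f x W) A"
  using assms
  by (induction S rule: infinite_finite_induct) (auto intro: cdiff_at_const cdiff_at_add)

lemma cdiff_at_coeff_mult:
  assumes "\<And>k. cdiff_at (\<lambda>W. coeff (f W) k) A" "\<And>k. cdiff_at (\<lambda>W. coeff (g W) k) A"
  shows "cdiff_at (\<lambda>W. coeff (f W * g W) k) A"
  unfolding coeff_mult by (intro cdiff_at_sum cdiff_at_mult assms)

lemma cdiff_at_coeff_prod:
  assumes "\<And>x k. x \<in> S \<Longrightarrow> cdiff_at (\<lambda>W. coeff (f x W) k) A"
  shows "cdiff_at (\<lambda>W. coeff (\<Prod>x\<in>S. f x W) k) A"
  using assms
proof (induction S arbitrary: k rule: infinite_finite_induct)
  case (insert x S)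
  then show ?case by (auto intro!: cdiff_at_coeff_mult)
qed (auto intro: cdiff_at_const)

lemma cdiff_at_char_coeff:
  fixes A :: "complex^'n^'n"
  shows "cdiff_at (char_coeff k) A"
proof -
  have entry: "cdiff_at (\<lambda>W. coeff ((if i = j then [:0, 1:] else 0) - [:W $ i $ j:]) m) A"
    for i j :: 'n and m
  proof -
    have eq: "coeff ((if i = j then [:0, 1:] else 0) - [:W $ i $ j:]) m =
        coeff (if i = j then [:0, 1:] else 0) m + coeff [:-1:] m * W $ i $ j" for W :: "complex^'n^'n"
      by (simp add: coeff_pCons split: nat.split)
    show ?thesis unfolding eq
      by (intro cdiff_at_add cdiff_at_mult cdiff_at_const cdiff_at_entry)
  qed
  have sign: "cdiff_at (\<lambda>W. coeff (of_int (sign p)) m) A" for p :: "'n \<Rightarrow> 'n" and m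
    by (rule cdiff_at_const)
  have "cdiff_at (\<lambda>W. coeff (char_polynomial W) m) A" for m
    unfolding char_polynomial_def det_def coeff_sum
    by (intro cdiff_at_sum cdiff_at_coeff_mult cdiff_at_coeff_prod sign) (simp only: vec_lambda_beta entry)
  then show ?thesis
    unfolding char_coeff_def[abs_def] by (intro cdiff_at_mult cdiff_at_const)
qed

lemma char_coeffs_complex_differentiable:
  "\<exists>D. (char_coeffs has_derivative D) (at A) \<and>
     (\<forall>a H. D (map_matrix (\<lambda>x. a * x) H) = a *s D H)"
proof -
  obtain D where D: "\<And>k. (char_coeff k has_derivative D k) (at A)"
    "\<And>k a H. D k (map_matrix (\<lambda>x. a * x) H) = a * D k H"
    using cdiff_at_char_coeff[of _ A] unfolding cdiff_at_def by metis
  have "(char_coeffs has_derivative (\<lambda>H. \<chi> i. D (card {..i}) H)) (at A)"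
    unfolding char_coeffs_def[abs_def]
    by (subst has_derivative_componentwise_within)
       (auto simp: Basis_vec_def inner_axis intro!: has_derivative_inner_left D(1))
  with D(2) show ?thesis
    by (intro exI[of _ "\<lambda>H. \<chi> i. D (card {..i}) H"]) (auto simp: vec_eq_iff)
qed

lemma frechet_derivative_char_coeffs:
  shows "(char_coeffs has_derivative frechet_derivative char_coeffs (at A)) (at A)"
    and "frechet_derivative char_coeffs (at A) (map_matrix (\<lambda>x. a * x) H) =
           a *s frechet_derivative char_coeffs (at A) H"
proof -
  obtain D where D: "(char_coeffs has_derivative D) (at A)"
    "\<And>a H. D (map_matrix (\<lambda>x. a * x) H) = a *s D H"
    using char_coeffs_complex_differentiable[of A] by blast
  have "D = frechet_derivative char_coeffs (at A)"
    by (rule frechet_derivative_at[OF D(1)])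
  with D show "(char_coeffs has_derivative frechet_derivative char_coeffs (at A)) (at A)"
    and "frechet_derivative char_coeffs (at A) (map_matrix (\<lambda>x. a * x) H) =
           a *s frechet_derivative char_coeffs (at A) H"
    by simp_all
qed

end

theory Submission
  imports Defs
begin

text \<open>Let \<open>B\<^sub>m\<close> be the coefficient of \<open>t\<^sup>m\<close> in \<open>adj (t I - A)\<close>. Changing the entry \<open>(i, j)\<close> of \<open>A\<close> by \<open>s\<close>
  changes the characteristic polynomial by exactly \<open>-s\<close> times the \<open>(j, i)\<close> entry of \<open>adj (t I - A)\<close>.
  So the components of \<open>c'(A)\<close> are, up to signs, the functionals \<open>H \<mapsto> tr (B\<^sub>m H)\<close>, and
  the rank is \<open>dim (span {B\<^sub>m})\<close>. The recursion \<open>B\<^sub>m\<^sub>-\<^sub>1 = A B\<^sub>m + p\<^sub>m I\<close> shows that the \<open>B\<^sub>m\<close> span the same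
  space as the powers of \<open>A\<close>, whose dimension is the least \<open>k\<close> for which \<open>A\<^sup>k\<close> depends linearly on the
  lower powers, which is the degree of the minimal polynomial.\<close>

section \<open>Row rank and column rank over a field\<close>

text \<open>Writing the columns in a basis \<open>B\<close> of their span factors \<open>A\<close>
  through \<open>card B\<close> coordinates. Read along the rows, the same factorization expresses
  every row through the vectors \<open>R b\<close>.\<close>

lemma dim_rows_le_dim_columns_field:
  fixes A :: "'a::field^'n^'m"
  shows "vec.dim (rows A) \<le> vec.dim (columns A)"
proof -
  obtain B where B: "vec.independent B" "columns A \<subseteq> vec.span B" "card B = vec.dim (columns A)"
    by (metis vec.basis_exists)
  have fin: "finite B" using B(1) by (rule vec.finiteI_independent)
  have "\<exists>u. (\<Sum>b\<in>B. u b *s b) = column j A" for j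
  proof -
    have "column j A \<in> vec.span B" using B(2) by (auto simp: columns_def)
    then show ?thesis by (auto simp: vec.span_finite[OF fin])
  qed
  then obtain u where u: "\<And>j. (\<Sum>b\<in>B. u j b *s b) = column j A" by metis
  define R where "R b = (\<chi> j. u j b)" for b
  have "row i A = (\<Sum>b\<in>B. b $ i *s R b)" for i
  proof -
    have "A $ i $ j = (\<Sum>b\<in>B. b $ i * u j b)" for j
      using arg_cong[OF u[of j], of "\<lambda>v. v $ i"] by (simp add: column_def mult.commute)
    then show ?thesis by (simp add: vec_eq_iff row_def R_def)
  qed
  moreover have "(\<Sum>b\<in>B. b $ i *s R b) \<in> vec.span (R ` B)" for i
    by (intro vec.span_sum vec.span_scale vec.span_base imageI)
  ultimately have "rows A \<subseteq> vec.span (R ` B)" by (auto simp: rows_def)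
  then have "vec.dim (rows A) \<le> card (R ` B)" using fin by (intro vec.dim_le_card) auto
  also have "\<dots> \<le> card B" using fin by (rule card_image_le)
  finally show ?thesis using B(3) by simp
qed

lemma dim_rows_eq_dim_columns_field:
  fixes A :: "'a::field^'n^'m"
  shows "vec.dim (rows A) = vec.dim (columns A)"
  using dim_rows_le_dim_columns_field[of A] dim_rows_le_dim_columns_field[of "transpose A"]
  by simp

text \<open>The vectors on the right are the rows of \<open>matrix f\<close>, so the rank can be
  computed from the component functionals of \<open>f\<close>, which is how the derivative will be
  known.\<close>

lemma dim_range_linear_eq_dim_rows:
  fixes f :: "'a::field^'n \<Rightarrow> 'a^'m"
  assumes "Vector_Spaces.linear (*s) (*s) f"
  shows "vec.dim (range f) = vec.dim (range (\<lambda>k. \<chi> j. f (axis j 1) $ k))"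
proof -
  have "range f \<subseteq> vec.span (columns (matrix f))"
    using matrix_vector_mult_in_columnspace_gen[of "matrix f"] matrix_works[OF assms] by force
  moreover have "columns (matrix f) \<subseteq> range f"
    by (auto simp: columns_def column_def matrix_def)
  ultimately have "vec.dim (range f) = vec.dim (columns (matrix f))"
    by (metis vec.dim_subset vec.dim_span le_antisym)
  also have "\<dots> = vec.dim (rows (matrix f))" by (simp add: dim_rows_eq_dim_columns_field)
  also have "rows (matrix f) = range (\<lambda>k. \<chi> j. f (axis j 1) $ k)"
    by (auto simp: rows_def row_def matrix_def)
  finally show ?thesis .
qed

section \<open>Dimension of the orbit of a vector under a linear map\<close>

lemma independent_image_lessThan:
  fixes g :: "nat \<Rightarrow> 'a::field^'n"
  assumes "\<And>j. j < k \<Longrightarrow> g j \<notin> vec.span (g ` {..<j})"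
  shows "vec.independent (g ` {..<k})" and "card (g ` {..<k}) = k"
proof -
  have "vec.independent (g ` {..<k}) \<and> card (g ` {..<k}) = k"
    using assms
  proof (induction k)
    case (Suc k)
    have "g k \<notin> vec.span (g ` {..<k})" using Suc.prems by simp
    moreover from this have "g k \<notin> g ` {..<k}" by (meson vec.span_base)
    moreover have "vec.independent (g ` {..<k})" "card (g ` {..<k}) = k" using Suc by simp_all
    ultimately show ?case by (simp add: lessThan_Suc vec.independent_insertI)
  qed (simp add: vec.independent_empty)
  then show "vec.independent (g ` {..<k})" and "card (g ` {..<k}) = k" by simp_all
qed

text \<open>Otherwise there would be independent families of every size in a finite-dimensional
  space.\<close>

lemma orbit_LeastI:
  fixes g :: "nat \<Rightarrow> 'a::field^'n"
  defines "d \<equiv> LEAST k. g k \<in> vec.span (g ` {..<k})"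
  shows "g d \<in> vec.span (g ` {..<d})"
proof -
  have "\<exists>k. g k \<in> vec.span (g ` {..<k})"
  proof (rule ccontr)
    assume "\<nexists>k. g k \<in> vec.span (g ` {..<k})"
    then have g: "vec.independent (g ` {..<k})" "card (g ` {..<k}) = k" for k
      using independent_image_lessThan[of k g] by auto
    have "k \<le> vec.dim (UNIV :: ('a^'n) set)" for k
      using vec.independent_card_le_dim[OF subset_UNIV g(1)[of k]] g(2)[of k] by simp
    then show False using Suc_n_not_le_n by blast
  qed
  then show ?thesis unfolding d_def by (rule LeastI_ex)
qed

text \<open>\<open>T\<close> moves each of the first \<open>d\<close> terms to the next, and the
  last one to \<open>g d\<close>, which falls back into their span. So this span is invariant and
  contains the orbit, and minimality of \<open>d\<close> makes those terms independent.\<close>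

lemma dim_orbit:
  fixes g :: "nat \<Rightarrow> 'a::field^'n"
  assumes T: "Vector_Spaces.linear (*s) (*s) T" and g: "\<And>k. g (Suc k) = T (g k)"
  shows "vec.dim (range g) = (LEAST k. g k \<in> vec.span (g ` {..<k}))"
proof -
  define d where "d = (LEAST k. g k \<in> vec.span (g ` {..<k}))"
  let ?S = "vec.span (g ` {..<d})"
  have gd: "g d \<in> ?S" unfolding d_def by (rule orbit_LeastI)
  have "T ` ?S = vec.span (T ` g ` {..<d})" using vec.linear_span_image[OF T] by simp
  also have "\<dots> \<subseteq> ?S"
  proof (rule vec.span_minimal)
    show "T ` g ` {..<d} \<subseteq> ?S"
    proof clarify
      fix j assume "j < d"
      then consider "Suc j < d" | "Suc j = d" by linarith
      then show "T (g j) \<in> ?S" using gd by cases (auto simp flip: g intro: vec.span_base)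
    qed
  qed simp
  finally have inv: "T ` ?S \<subseteq> ?S" .
  have "g k \<in> ?S" for k
  proof (induction k)
    case 0
    \<comment> \<open>If \<open>d = 0\<close>, then \<open>gd\<close> is already the claim;
      otherwise \<open>g 0\<close> is a generator.\<close>
    show ?case using gd by (cases d) (auto intro: vec.span_base)
  qed (use inv g in auto)
  moreover have "vec.independent (g ` {..<d})" "card (g ` {..<d}) = d"
    using independent_image_lessThan[of d g] not_less_Least unfolding d_def by blast+
  ultimately have "vec.dim (range g) = d" by (intro vec.dim_unique[of "g ` {..<d}"]) auto
  then show ?thesis by (simp add: d_def)
qed

text \<open>The coefficients are indexed by \<open>j\<close> and not by the vectors
  \<open>g j\<close>, so that they can become coefficients of a polynomial even where
  \<open>g\<close> repeats values.\<close>

lemma span_image_lessThan_iff: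
  fixes g :: "nat \<Rightarrow> 'a::field^'n"
  shows "v \<in> vec.span (g ` {..<k}) \<longleftrightarrow> (\<exists>c. v = (\<Sum>j<k. c j *s g j))"
proof
  show "v \<in> vec.span (g ` {..<k}) \<Longrightarrow> \<exists>c. v = (\<Sum>j<k. c j *s g j)"
  proof (induction k arbitrary: v)
    case (Suc k)
    then obtain a where "v - a *s g k \<in> vec.span (g ` {..<k})"
      by (auto simp: lessThan_Suc vec.span_breakdown_eq)
    with Suc.IH obtain c where "v - a *s g k = (\<Sum>j<k. c j *s g j)" by blast
    then have "v = (\<Sum>j<k. c j *s g j) + a *s g k" by (simp add: diff_eq_eq)
    then have "v = (\<Sum>j<Suc k. (c(k := a)) j *s g j)" by simp
    then show ?case by blast
  qed simp
next
  show "\<exists>c. v = (\<Sum>j<k. c j *s g j) \<Longrightarrow> v \<in> vec.span (g ` {..<k})"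
    by (elim exE, hypsubst, intro vec.span_sum vec.span_scale vec.span_base imageI)
qed

section \<open>Characteristic matrix and cofactors\<close>

text \<open>This is \<open>t I - W\<close>, with \<open>[:0, 1:]\<close> as the variable
  \<open>t\<close>.\<close>

definition char_matrix :: "'a::comm_ring_1^'n^'n \<Rightarrow> 'a poly^'n^'n" where
  "char_matrix W = (\<chi> i j. (if i = j then [:0, 1:] else 0) - [:W $ i $ j:])"

lemma char_polynomial_eq_det: "char_polynomial W = det (char_matrix W)"
  by (simp add: char_polynomial_def char_matrix_def)

text \<open>The signed cofactor, that is, the \<open>(j, i)\<close> entry of the adjugate. Replacing
  a row instead of deleting a row and a column keeps the index type and makes multilinearity of
  \<open>det\<close> directly applicable.\<close>

definition cofactor :: "'a::comm_ring_1^'n^'n \<Rightarrow> 'n \<Rightarrow> 'n \<Rightarrow> 'a" where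
  "cofactor X i j = det (\<chi> r. if r = i then axis j 1 else row r X)"

text \<open>Laplace expansion along row \<open>i\<close>: expand \<open>v\<close> in the standard
  basis and use linearity in that row.\<close>

lemma det_replace_row:
  fixes X :: "'a::comm_ring_1^'n^'n"
  shows "det (\<chi> r. if r = i then v else row r X) = (\<Sum>j\<in>UNIV. v $ j * cofactor X i j)"
proof -
  have "det (\<chi> r. if r = i then v else row r X) =
      det (\<chi> r. if r = i then (\<Sum>j\<in>UNIV. v $ j *s axis j 1) else row r X)"
    by (subst basis_expansion) (rule refl)
  also have "\<dots> = (\<Sum>j\<in>UNIV. v $ j * cofactor X i j)"
    by (simp add: det_linear_row_sum det_row_mul cofactor_def)
  finally show ?thesis .
qed

lemma replace_row_same: "(\<chi> r. if r = i then row i X else row r X) = X"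
  by (simp add: vec_eq_iff row_def)

text \<open>These are the entries of \<open>X adj X = det X I\<close>. Off the diagonal, the sum is
  the determinant of a matrix in which rows \<open>i\<close> and \<open>k\<close> agree.\<close>

lemma sum_mult_cofactor:
  fixes X :: "'a::comm_ring_1^'n^'n"
  shows "(\<Sum>j\<in>UNIV. X $ k $ j * cofactor X i j) = (if i = k then det X else 0)"
proof -
  let ?Y = "\<chi> r. if r = i then row k X else row r X"
  have "(\<Sum>j\<in>UNIV. X $ k $ j * cofactor X i j) = det ?Y"
    by (simp add: det_replace_row row_def)
  also have "\<dots> = (if i = k then det X else 0)"
  proof (cases "i = k")
    case True
    then show ?thesis by (simp add: replace_row_same cong: if_cong)
  next
    case False
    then have "row i ?Y = row k ?Y" by (simp add: row_def vec_eq_iff)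
    with False show ?thesis by (simp add: det_identical_rows)
  qed
  finally show ?thesis .
qed

text \<open>The dependence on \<open>c\<close> is exactly affine, so a derivative in the direction
  of one entry can be read off without estimating a remainder.\<close>

lemma det_perturb_row:
  fixes X :: "'a::comm_ring_1^'n^'n"
  shows "det (\<chi> r. if r = i then row i X + c *s axis j 1 else row r X) = det X + c * cofactor X i j"
  by (simp add: det_row_add det_row_mul replace_row_same cofactor_def)

text \<open>The variable occurs only on the diagonal, so only fixed points of \<open>p\<close>
  contribute to the degree.\<close>

lemma degree_of_int_sign_mult_prod:
  fixes W :: "'a::idom^'n^'n"
  shows "degree (of_int (sign p) * (\<Prod>i\<in>UNIV. char_matrix W $ i $ p i)) \<le> card {i. p i = i}"
proof -
  have "degree (\<Prod>i\<in>UNIV. char_matrix W $ i $ p i) \<le> (\<Sum>i\<in>UNIV. degree (char_matrix W $ i $ p i))"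
    using degree_prod_sum_le[of UNIV "\<lambda>i. char_matrix W $ i $ p i"] by (simp add: o_def)
  also have "\<dots> \<le> (\<Sum>i\<in>UNIV. if p i = i then 1 else 0)"
    by (intro sum_mono) (auto simp: char_matrix_def)
  also have "\<dots> = card {i. p i = i}" by (simp add: sum.If_cases)
  finally show ?thesis by (auto simp: sign_def)
qed

lemma degree_char_polynomial_le:
  fixes W :: "complex^'n^'n"
  shows "degree (char_polynomial W) \<le> CARD('n)"
  unfolding char_polynomial_eq_det det_def
  by (intro degree_sum_le order.trans[OF degree_of_int_sign_mult_prod] card_mono finite_permutations) auto

text \<open>In the Leibniz formula only the identity fixes all indices, and its term is a product of
  monic linear factors.\<close>

lemma coeff_char_polynomial_CARD:
  fixes W :: "complex^'n^'n"
  shows "coeff (char_polynomial W) CARD('n) = 1"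
proof -
  let ?P = "{p. p permutes (UNIV :: 'n set)}"
  let ?t = "\<lambda>p. of_int (sign p) * (\<Prod>i\<in>UNIV. char_matrix W $ i $ p i)"
  have "coeff (?t p) CARD('n) = 0" if "p \<noteq> id" for p
  proof (rule coeff_eq_0)
    have "card {i. p i = i} < CARD('n)" using that by (intro psubset_card_mono) (auto simp: fun_eq_iff)
    then show "degree (?t p) < CARD('n)"
      using degree_of_int_sign_mult_prod[of p W] by linarith
  qed
  then have "coeff (char_polynomial W) CARD('n) = coeff (?t id) CARD('n)"
    unfolding char_polynomial_eq_det det_def coeff_sum
    by (subst sum.remove[of _ id]) (auto simp: permutes_id finite_permutations intro!: sum.neutral)
  also have "?t id = (\<Prod>i\<in>UNIV. [:- (W $ i $ i), 1:])"
    by (simp add: char_matrix_def)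
  also have "coeff \<dots> CARD('n) = lead_coeff (\<Prod>i\<in>UNIV. [:- (W $ i $ i), 1:])"
    by (simp add: degree_prod_eq_sum_degree)
  also have "\<dots> = 1" by (simp add: lead_coeff_prod)
  finally show ?thesis .
qed

section \<open>Coefficients of the adjugate of the characteristic matrix\<close>

text \<open>The matrix \<open>B\<^sub>m\<close>; the order of \<open>j\<close> and \<open>i\<close>
  performs the transposition from cofactors to the adjugate.\<close>

definition adj_coeff :: "'a::comm_ring_1^'n^'n \<Rightarrow> nat \<Rightarrow> 'a^'n^'n" where
  "adj_coeff W m = (\<chi> j i. coeff (cofactor (char_matrix W) i j) m)"

text \<open>Comparison of coefficients in \<open>(t I - W) adj (t I - W) = det (t I - W) I\<close>.\<close>

lemma adj_coeff_rec:
  "(\<chi> k i. coeff ([:0, 1:] * cofactor (char_matrix W) i k) m) - W ** adj_coeff W m =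
     (\<chi> k i. if i = k then coeff (char_polynomial W) m else 0)"
proof -
  have "coeff ([:0, 1:] * cofactor (char_matrix W) i k) m - (W ** adj_coeff W m) $ k $ i
      = (if i = k then coeff (char_polynomial W) m else 0)" for i k
  proof -
    let ?C = "cofactor (char_matrix W) i"
    have "(\<Sum>j\<in>UNIV. char_matrix W $ k $ j * ?C j) =
        (\<Sum>j\<in>UNIV. if k = j then [:0, 1:] * ?C j else 0) - (\<Sum>j\<in>UNIV. [:W $ k $ j:] * ?C j)"
      unfolding sum_subtractf[symmetric]
      by (intro sum.cong) (auto simp: char_matrix_def algebra_simps)
    also have "\<dots> = [:0, 1:] * ?C k - (\<Sum>j\<in>UNIV. [:W $ k $ j:] * ?C j)"
      by simp
    finally have "[:0, 1:] * ?C k - (\<Sum>j\<in>UNIV. [:W $ k $ j:] * ?C j)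
        = (if i = k then char_polynomial W else 0)"
      by (simp only: sum_mult_cofactor char_polynomial_eq_det)
    from arg_cong[OF this, of "\<lambda>p. coeff p m"] show ?thesis
      by (simp add: coeff_sum matrix_matrix_mult_def adj_coeff_def)
  qed
  then show ?thesis by (simp add: vec_eq_iff)
qed

lemma matrix_mult_adj_coeff_Suc:
  "W ** adj_coeff W (Suc m) = adj_coeff W m - map_matrix (\<lambda>x. coeff (char_polynomial W) (Suc m) * x) (mat 1)"
  using adj_coeff_rec[of W "Suc m"]
  by (auto simp: vec_eq_iff adj_coeff_def mat_def algebra_simps)

lemma matrix_mult_adj_coeff_0:
  "W ** adj_coeff W 0 = - map_matrix (\<lambda>x. coeff (char_polynomial W) 0 * x) (mat 1)"
proof -
  have "- (W ** adj_coeff W 0) = map_matrix (\<lambda>x. coeff (char_polynomial W) 0 * x) (mat 1)"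
    using adj_coeff_rec[of W 0] by (auto simp: vec_eq_iff mat_def)
  then show ?thesis by (metis minus_minus)
qed

text \<open>Downward induction with the recursion: from index \<open>CARD('n)\<close> on, both the
  next adjugate coefficient and the next coefficient of the characteristic polynomial
  vanish.\<close>

lemma adj_coeff_eq_0:
  fixes W :: "complex^'n^'n"
  assumes "m \<ge> CARD('n)"
  shows "adj_coeff W m = 0"
proof -
  \<comment> \<open>A crude index that is at least \<open>m\<close> and exceeds every cofactor
    degree, from which the induction can descend.\<close>
  define N where "N = m + (\<Sum>i\<in>UNIV. \<Sum>j\<in>UNIV. Suc (degree (cofactor (char_matrix W) i j)))"
  have "degree (cofactor (char_matrix W) i j) < N" for i j
  proof -
    have "Suc (degree (cofactor (char_matrix W) i j)) \<le> (\<Sum>j\<in>UNIV. Suc (degree (cofactor (char_matrix W) i j)))"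
      by (rule member_le_sum) auto
    also have "\<dots> \<le> (\<Sum>i\<in>UNIV. \<Sum>j\<in>UNIV. Suc (degree (cofactor (char_matrix W) i j)))"
      by (rule member_le_sum) auto
    finally show ?thesis by (simp add: N_def)
  qed
  then have N: "adj_coeff W N = 0" by (simp add: adj_coeff_def vec_eq_iff coeff_eq_0)
  have "m \<le> N" by (simp add: N_def)
  then show ?thesis
  proof (induction rule: inc_induct)
    case base
    show ?case by (rule N)
  next
    case (step k)
    have "degree (char_polynomial W) < Suc k"
      using degree_char_polynomial_le[of W] step assms by linarith
    then have "coeff (char_polynomial W) (Suc k) = 0" by (rule coeff_eq_0)
    moreover have "adj_coeff W (Suc k) = 0" using step by simp
    ultimately show ?case using matrix_mult_adj_coeff_Suc[of W k]
      by (simp add: vec_eq_iff matrix_matrix_mult_def)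
  qed
qed

text \<open>At index \<open>CARD('n)\<close> the recursion has zero on the left and leading
  coefficient 1 on the right.\<close>

lemma adj_coeff_top:
  fixes W :: "complex^'n^'n"
  shows "adj_coeff W (CARD('n) - 1) = mat 1"
  using matrix_mult_adj_coeff_Suc[of W "CARD('n) - 1"]
    adj_coeff_eq_0[of "CARD('n)" W] coeff_char_polynomial_CARD[of W]
  by (simp add: vec_eq_iff matrix_matrix_mult_def)

section \<open>Matrices as vectors over the field\<close>

text \<open>\<open>vec.span\<close> and \<open>vec.dim\<close> take scalars in the entry type of a
  vector. The entries of a matrix are its rows, so it is re-indexed by pairs to obtain scalars in
  the field.\<close>

definition flatten :: "'a^'n^'m \<Rightarrow> 'a^('m \<times> 'n)" where
  "flatten M = (\<chi> p. M $ fst p $ snd p)"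

definition unflatten :: "'a^('m \<times> 'n) \<Rightarrow> 'a^'n^'m" where
  "unflatten v = (\<chi> i j. v $ (i, j))"

lemma unflatten_flatten [simp]: "unflatten (flatten M) = M"
  by (simp add: flatten_def unflatten_def vec_eq_iff)

lemma flatten_eq_0_iff [simp]: "flatten M = 0 \<longleftrightarrow> M = 0"
  by (auto simp: flatten_def vec_eq_iff)

lemma flatten_0 [simp]: "flatten 0 = 0"
  by simp

lemma flatten_add: "flatten (M + N) = flatten M + flatten N"
  by (simp add: flatten_def vec_eq_iff)

lemma flatten_diff: "flatten (M - N) = flatten M - flatten N"
  by (simp add: flatten_def vec_eq_iff)

lemma flatten_minus: "flatten (- M) = - flatten M"
  by (simp add: flatten_def vec_eq_iff)

lemma flatten_sum: "flatten (\<Sum>i\<in>S. f i) = (\<Sum>i\<in>S. flatten (f i))"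
  by (induction S rule: infinite_finite_induct) (simp_all add: flatten_add)

lemma flatten_scale: "flatten (map_matrix (\<lambda>x. c * x) M) = c *s flatten M"
  by (simp add: flatten_def vec_eq_iff)

definition left_mult :: "'a::field^'n^'n \<Rightarrow> 'a^('n \<times> 'n) \<Rightarrow> 'a^('n \<times> 'n)" where
  "left_mult A v = flatten (A ** unflatten v)"

lemma left_mult_flatten [simp]: "left_mult A (flatten M) = flatten (A ** M)"
  by (simp add: left_mult_def)

lemma linear_left_mult: "Vector_Spaces.linear (*s) (*s) (left_mult A)"
  by (simp add: Vector_Spaces.linear_iff vec.vector_space_axioms left_mult_def flatten_def
      unflatten_def matrix_matrix_mult_def vec_eq_iff sum.distrib sum_distrib_left algebra_simps)

definition flat_power :: "'a::field^'n^'n \<Rightarrow> nat \<Rightarrow> 'a^('n \<times> 'n)" where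
  "flat_power A k = flatten (((\<lambda>B. A ** B) ^^ k) (mat 1))"

lemma flat_power_0: "flat_power A 0 = flatten (mat 1)"
  by (simp add: flat_power_def)

lemma flat_power_Suc: "flat_power A (Suc k) = left_mult A (flat_power A k)"
  by (simp add: flat_power_def)

lemma left_mult_adj_coeff_Suc:
  "left_mult A (flatten (adj_coeff A (Suc m))) =
     flatten (adj_coeff A m) - coeff (char_polynomial A) (Suc m) *s flat_power A 0"
  by (simp add: matrix_mult_adj_coeff_Suc flatten_diff flatten_scale flat_power_0)

lemma left_mult_adj_coeff_0:
  "left_mult A (flatten (adj_coeff A 0)) = - (coeff (char_polynomial A) 0 *s flat_power A 0)"
  by (simp add: matrix_mult_adj_coeff_0 flatten_minus flatten_scale flat_power_0)

section \<open>Adjugate coefficients and powers span the same space\<close>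

text \<open>Both spans contain the identity and are invariant under left multiplication by
  \<open>A\<close>. The recursion then yields the adjugate coefficients by descent from zero, and
  the powers by ascent from the identity, which is itself the top adjugate coefficient.\<close>

lemma span_adj_coeff_eq_span_power:
  fixes A :: "complex^'n^'n"
  shows "vec.span (range (\<lambda>m. flatten (adj_coeff A m))) = vec.span (range (flat_power A))"
    (is "?B = ?P")
proof (rule antisym)
  have P_inv: "left_mult A v \<in> ?P" if "v \<in> ?P" for v
  proof -
    have "left_mult A ` ?P = vec.span (left_mult A ` range (flat_power A))"
      by (rule vec.linear_span_image[OF linear_left_mult, symmetric])
    also have "\<dots> \<subseteq> ?P" by (intro vec.span_mono) (auto simp flip: flat_power_Suc)
    finally show ?thesis using that by blast
  qed
  have "flatten (adj_coeff A m) \<in> ?P" for m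
  proof (cases "m \<le> CARD('n)")
    case True
    then show ?thesis
    proof (induction rule: inc_induct)
      case base
      show ?case by (simp add: adj_coeff_eq_0 vec.span_zero)
    next
      case (step k)
      have "flatten (adj_coeff A k) = left_mult A (flatten (adj_coeff A (Suc k)))
          + coeff (char_polynomial A) (Suc k) *s flat_power A 0"
        by (simp only: left_mult_adj_coeff_Suc diff_add_cancel)
      also have "\<dots> \<in> ?P"
        by (intro vec.span_add P_inv step.IH vec.span_scale vec.span_base rangeI)
      finally show ?case .
    qed
  qed (simp add: adj_coeff_eq_0 vec.span_zero)
  then show "?B \<subseteq> ?P" by (intro vec.span_minimal) auto
next
  have one: "flat_power A 0 \<in> ?B"
    unfolding flat_power_0 adj_coeff_top[of A, symmetric] by (intro vec.span_base rangeI)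
  have "left_mult A (flatten (adj_coeff A m)) \<in> ?B" for m
  proof (cases m)
    case 0
    then show ?thesis
      by (simp only: left_mult_adj_coeff_0) (intro vec.span_neg vec.span_scale one)
  next
    case (Suc k)
    then show ?thesis
      by (simp only: left_mult_adj_coeff_Suc)
        (intro vec.span_diff vec.span_scale one vec.span_base rangeI)
  qed
  then have "vec.span (left_mult A ` range (\<lambda>m. flatten (adj_coeff A m))) \<subseteq> ?B"
    by (intro vec.span_minimal) auto
  then have B_inv: "left_mult A ` ?B \<subseteq> ?B"
    by (subst (asm) vec.linear_span_image[OF linear_left_mult])
  have "flat_power A k \<in> ?B" for k
    by (induction k) (use one B_inv in \<open>auto simp: flat_power_Suc\<close>)
  then show "?P \<subseteq> ?B" by (intro vec.span_minimal) auto
qed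

section \<open>Degree of the minimal polynomial\<close>

text \<open>The free bound \<open>N\<close> lets polynomials of different degrees share one range of
  summation.\<close>

lemma flatten_poly_matrix:
  assumes "degree q \<le> N"
  shows "flatten (poly_matrix q A) = (\<Sum>i\<le>N. coeff q i *s flat_power A i)"
proof -
  have "flatten (poly_matrix q A) = (\<Sum>i\<le>degree q. coeff q i *s flat_power A i)"
    by (simp add: poly_matrix_def flatten_sum flatten_scale flat_power_def)
  also have "\<dots> = (\<Sum>i\<le>N. coeff q i *s flat_power A i)"
    using assms by (intro sum.mono_neutral_left) (auto simp: coeff_eq_0)
  finally show ?thesis .
qed

text \<open>A monic annihilator of degree \<open>k\<close> is the same as a relation that solves for
  the \<open>k\<close>-th power in terms of lower ones, with the signs of the coefficients
  reversed.\<close>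

lemma ex_monic_annihilator_iff:
  "(\<exists>q. lead_coeff q = 1 \<and> degree q = k \<and> poly_matrix q A = 0) \<longleftrightarrow>
     flat_power A k \<in> vec.span (flat_power A ` {..<k})"
proof
  assume "\<exists>q. lead_coeff q = 1 \<and> degree q = k \<and> poly_matrix q A = 0"
  then obtain q where q: "coeff q k = 1" "degree q = k" "poly_matrix q A = 0" by auto
  have "0 = (\<Sum>i\<le>k. coeff q i *s flat_power A i)"
    using flatten_poly_matrix[of q k A] q by simp
  also have "\<dots> = (\<Sum>i<k. coeff q i *s flat_power A i) + flat_power A k"
    using q(1) by (simp add: lessThan_Suc_atMost[symmetric])
  finally have "flat_power A k = (\<Sum>i<k. (- coeff q i) *s flat_power A i)"
    by (simp add: sum_negf add_eq_0_iff)
  then show "flat_power A k \<in> vec.span (flat_power A ` {..<k})"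
    unfolding span_image_lessThan_iff by (rule exI[of _ "\<lambda>i. - coeff q i"])
next
  assume "flat_power A k \<in> vec.span (flat_power A ` {..<k})"
  then obtain c where c: "flat_power A k = (\<Sum>j<k. c j *s flat_power A j)"
    by (auto simp: span_image_lessThan_iff)
  define q where "q = monom 1 k - (\<Sum>j<k. monom (c j) j)"
  have coeff_q: "coeff q i = (if i = k then 1 else if i < k then - c i else 0)" for i
    by (simp add: q_def coeff_sum)
  have deg: "degree q = k"
    by (intro antisym degree_le le_degree) (simp_all add: coeff_q)
  have "flatten (poly_matrix q A) = (\<Sum>i<k. coeff q i *s flat_power A i) + flat_power A k"
    using flatten_poly_matrix[of q k A] by (simp add: deg coeff_q lessThan_Suc_atMost[symmetric])
  also have "\<dots> = 0"
    by (simp add: coeff_q c sum_negf)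
  finally show "\<exists>q. lead_coeff q = 1 \<and> degree q = k \<and> poly_matrix q A = 0"
    using deg coeff_q by (intro exI[of _ q]) simp
qed

text \<open>The definite description needs uniqueness: the difference of two distinct monic
  annihilators of least degree would, once normalized, be a monic annihilator of smaller
  degree.\<close>

lemma degree_min_polynomial:
  "degree (min_polynomial A) = (LEAST k. flat_power A k \<in> vec.span (flat_power A ` {..<k}))"
proof -
  define d where "d = (LEAST k. flat_power A k \<in> vec.span (flat_power A ` {..<k}))"
  have "flat_power A d \<in> vec.span (flat_power A ` {..<d})"
    unfolding d_def by (rule orbit_LeastI)
  then obtain p where p: "lead_coeff p = 1" "degree p = d" "poly_matrix p A = 0"
    unfolding ex_monic_annihilator_iff[symmetric] by blast
  have d_le: "d \<le> degree q" if "lead_coeff q = 1" "poly_matrix q A = 0" for q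
    unfolding d_def by (rule Least_le) (use that ex_monic_annihilator_iff in blast)
  have "min_polynomial A = p"
    unfolding min_polynomial_def
  proof (rule the_equality)
    show "lead_coeff p = 1 \<and> poly_matrix p A = 0 \<and>
        (\<forall>q. lead_coeff q = 1 \<and> poly_matrix q A = 0 \<longrightarrow> degree p \<le> degree q)"
      using p d_le by simp
  next
    fix q assume "lead_coeff q = 1 \<and> poly_matrix q A = 0 \<and>
        (\<forall>p. lead_coeff p = 1 \<and> poly_matrix p A = 0 \<longrightarrow> degree q \<le> degree p)"
    then have q: "lead_coeff q = 1" "poly_matrix q A = 0" "degree q = d"
      using p d_le[of q] by (auto intro: antisym)
    show "q = p"
    proof (rule ccontr)
      assume "q \<noteq> p"
      define e where "e = q - p"
      \<comment> \<open>\<open>d_le\<close> speaks only of monic polynomials, so the difference is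
        rescaled.\<close>
      define r where "r = smult (inverse (lead_coeff e)) e"
      have "e \<noteq> 0" using \<open>q \<noteq> p\<close> by (simp add: e_def)
      have "degree e \<le> d" "coeff e d = 0"
        using p q by (auto simp: e_def intro: degree_diff_le)
      moreover have "lead_coeff e \<noteq> 0" using \<open>e \<noteq> 0\<close> by simp
      ultimately have "degree e < d" by (metis le_neq_implies_less)
      then have "degree r < d" by (simp add: r_def)
      moreover have "lead_coeff r = 1" using \<open>e \<noteq> 0\<close> by (simp add: r_def)
      moreover have "flatten (poly_matrix r A) =
          inverse (lead_coeff e) *s (flatten (poly_matrix q A) - flatten (poly_matrix p A))"
      proof -
        have "coeff r i = inverse (lead_coeff e) * (coeff q i - coeff p i)" for i
          by (simp add: r_def e_def)
        then show ?thesis using \<open>degree r < d\<close> p(2) q(3)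
          by (simp add: flatten_poly_matrix[of _ d] vec.scale_sum_right vec.scale_left_diff_distrib
              vec.scale_right_diff_distrib right_diff_distrib sum_subtractf)
      qed
      then have "poly_matrix r A = 0" using p q by simp
      ultimately show False using d_le[of r] by simp
    qed
  qed
  with p(2) show ?thesis by (simp add: d_def)
qed

section \<open>The derivative of the coefficient map\<close>

text \<open>Ensures that the components of \<open>char_coeffs\<close> are all of
  \<open>c\<^sub>1\<close> to \<open>c\<^sub>n\<close>, each occurring once.\<close>

lemma bij_betw_card_atMost:
  "bij_betw (\<lambda>k::'n::{finite,linorder}. card {..k}) UNIV {1..CARD('n)}"
proof -
  have "strict_mono (\<lambda>k::'n. card {..k})"
    by (intro strict_monoI psubset_card_mono) auto
  then have inj: "inj (\<lambda>k::'n. card {..k})" by (rule strict_mono_imp_inj_on)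
  have "range (\<lambda>k::'n. card {..k}) \<subseteq> {1..CARD('n)}"
    by (auto simp: Suc_le_eq card_gt_0_iff intro!: card_mono)
  then have "range (\<lambda>k::'n. card {..k}) = {1..CARD('n)}"
    by (rule card_subset_eq[rotated]) (simp_all add: card_image[OF inj])
  with inj show ?thesis by (simp add: bij_betw_def)
qed

text \<open>The direction is the matrix unit at \<open>(i, j)\<close>; it alters only row
  \<open>i\<close> of the characteristic matrix, by \<open>- s\<close> in column
  \<open>j\<close>.\<close>

lemma char_polynomial_perturb_entry:
  fixes A :: "complex^'n^'n"
  shows "char_polynomial (A + map_matrix (\<lambda>x. s * x) (\<chi> r. if r = i then axis j 1 else 0)) =
    char_polynomial A - smult s (cofactor (char_matrix A) i j)"
proof -
  have "char_matrix (A + map_matrix (\<lambda>x. s * x) (\<chi> r. if r = i then axis j 1 else 0)) =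
      (\<chi> r. if r = i then row i (char_matrix A) + [:- s:] *s axis j 1 else row r (char_matrix A))"
    by (auto simp: vec_eq_iff char_matrix_def row_def axis_def)
  then show ?thesis by (simp only: char_polynomial_eq_det det_perturb_row) simp
qed

text \<open>\<open>char_coeffs\<close> is affine along the real line through \<open>A\<close> in the
  direction of a matrix unit, so its slope \<open>v\<close> is the derivative there by the chain
  rule and uniqueness. The \<open>Suc\<close> in the exponent accounts for the minus sign in
  \<open>t I - A\<close>.\<close>

lemma frechet_derivative_char_coeffs_entry:
  fixes A :: "complex^('n::{finite,linorder})^('n::{finite,linorder})"
  shows "frechet_derivative char_coeffs (at A) (\<chi> r. if r = i then axis j 1 else 0) $ k =
    (-1) ^ Suc (card {..k}) * adj_coeff A (CARD('n) - card {..k}) $ j $ i"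
proof -
  let ?L = "frechet_derivative char_coeffs (at A)"
  let ?E = "(\<chi> r. if r = i then axis j 1 else 0) :: complex^('n::{finite,linorder})^('n::{finite,linorder})"
  define v :: "complex^('n::{finite,linorder})" where
    "v = (\<chi> k. (-1) ^ Suc (card {..k}) * adj_coeff A (CARD('n) - card {..k}) $ j $ i)"
  have "((\<lambda>s::real. A + s *\<^sub>R ?E) has_derivative (\<lambda>s. s *\<^sub>R ?E)) (at 0)"
    by (auto intro!: derivative_eq_intros)
  moreover have "(char_coeffs has_derivative ?L) (at (A + 0 *\<^sub>R ?E))"
    using frechet_derivative_char_coeffs(1)[of A] by simp
  ultimately have "((\<lambda>s::real. char_coeffs (A + s *\<^sub>R ?E)) has_derivative (\<lambda>s. ?L (s *\<^sub>R ?E))) (at 0)"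
    by (rule has_derivative_compose)
  moreover have "char_coeffs (A + s *\<^sub>R ?E) = char_coeffs A + s *\<^sub>R v" for s :: real
  proof -
    have "s *\<^sub>R ?E = map_matrix (\<lambda>x. complex_of_real s * x) ?E"
      by (simp add: vec_eq_iff scaleR_conv_of_real[where 'a=complex])
    then have cp: "char_polynomial (A + s *\<^sub>R ?E) =
        char_polynomial A - smult (complex_of_real s) (cofactor (char_matrix A) i j)"
      by (simp only: char_polynomial_perturb_entry)
    show ?thesis
      by (simp add: cp vec_eq_iff char_coeffs_def char_coeff_def v_def adj_coeff_def
          scaleR_conv_of_real[where 'a=complex] algebra_simps)
  qed
  then have "((\<lambda>s::real. char_coeffs (A + s *\<^sub>R ?E)) has_derivative (\<lambda>s. s *\<^sub>R v)) (at 0)"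
    by (auto intro!: derivative_eq_intros)
  ultimately have "(\<lambda>s::real. ?L (s *\<^sub>R ?E)) = (\<lambda>s. s *\<^sub>R v)"
    by (rule has_derivative_unique)
  from fun_cong[OF this, of 1] show ?thesis by (simp add: v_def)
qed

text \<open>Up to sign, the rows of the matrix of the derivative are the flattened adjugate
  coefficients of index below \<open>CARD('n)\<close>; signs do not affect the span, and the
  remaining coefficients are zero.\<close>

lemma map_rank_char_coeffs:
  fixes A :: "complex^('n::{finite,linorder})^('n::{finite,linorder})"
  shows "map_rank (frechet_derivative char_coeffs (at A)) =
    vec.dim (range (\<lambda>m. flatten (adj_coeff A m)))"
proof -
  let ?L = "frechet_derivative char_coeffs (at A)"
  \<comment> \<open>The transposition turns the row of \<open>f\<close> for \<open>tr (B\<^sub>m H)\<close> into \<open>flatten B\<^sub>m\<close>.\<close>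
  define f where "f v = ?L (\<chi> r c. v $ (c, r))" for v
  define w where "w m = flatten (adj_coeff A m)" for m
  let ?R = "range (\<lambda>k. (-1) ^ Suc (card {..k}) *s w (CARD('n) - card {..k::'n}))"
  have "range f = range ?L"
  proof -
    have "?L M = f (\<chi> p. M $ snd p $ fst p)" for M by (simp add: f_def)
    moreover have "f v = ?L (\<chi> r c. v $ (c, r))" for v by (rule f_def)
    ultimately show ?thesis by (metis (no_types, lifting) rangeI subset_antisym image_subsetI)
  qed
  \<comment> \<open>This is linearity over the reals and supplies additivity; complex homogeneity
    comes from \<open>frechet_derivative_char_coeffs(2)\<close>.\<close>
  have "linear ?L"
    using frechet_derivative_char_coeffs(1) by (rule has_derivative_linear)
  have "f (x + y) = f x + f y" for x y
  proof -
    have "(\<chi> r c. (x + y) $ (c, r)) = (\<chi> r c. x $ (c, r)) + (\<chi> r c. y $ (c, r))"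
      by (simp add: vec_eq_iff)
    then show ?thesis using linear_add[OF \<open>linear ?L\<close>] by (simp add: f_def)
  qed
  moreover have "f (a *s x) = a *s f x" for a x
  proof -
    have "(\<chi> r c. (a *s x) $ (c, r)) = map_matrix (\<lambda>x. a * x) (\<chi> r c. x $ (c, r))"
      by (simp add: vec_eq_iff)
    then show ?thesis using frechet_derivative_char_coeffs(2)[of A] by (simp add: f_def)
  qed
  ultimately have lin: "Vector_Spaces.linear (*s) (*s) f"
    by (simp add: Vector_Spaces.linear_iff vec.vector_space_axioms)
  have "f (axis (i, j) 1) $ k = (-1) ^ Suc (card {..k}) * adj_coeff A (CARD('n) - card {..k}) $ i $ j"
    for i j k
  proof -
    have eq: "(\<chi> r c. axis (i, j) 1 $ (c, r)) = (\<chi> r. if r = j then axis i 1 else 0)"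
      by (auto simp: vec_eq_iff axis_def)
    show ?thesis unfolding f_def eq by (rule frechet_derivative_char_coeffs_entry)
  qed
  then have "(\<chi> p. f (axis p 1) $ k) = (-1) ^ Suc (card {..k}) *s w (CARD('n) - card {..k})" for k
    by (simp add: vec_eq_iff w_def flatten_def split_paired_all)
  then have "map_rank ?L = vec.dim ?R"
    unfolding map_rank_def \<open>range f = range ?L\<close>[symmetric] dim_range_linear_eq_dim_rows[OF lin]
    by simp
  also have "vec.span ?R = vec.span (range w)"
  proof (intro antisym vec.span_minimal vec.subspace_span)
    show "?R \<subseteq> vec.span (range w)"
      by (intro image_subsetI vec.span_scale vec.span_base rangeI)
    have "w m \<in> vec.span ?R" for m
    proof (cases "m < CARD('n)")
      case True
      then have "CARD('n) - m \<in> range (\<lambda>k::'n. card {..k})"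
        using bij_betw_imp_surj_on[OF bij_betw_card_atMost] by auto
      then obtain k :: 'n where "card {..k} = CARD('n) - m" by auto
      with True have "CARD('n) - card {..k} = m" by simp
      \<comment> \<open>The sign is its own inverse, so scaling by it again recovers
        \<open>w m\<close>.\<close>
      then have "w m = (-1) ^ Suc (card {..k}) *s
          ((-1) ^ Suc (card {..k}) *s w (CARD('n) - card {..k}))"
        by (simp add: power_mult_distrib[symmetric] flip: power_add)
      also have "\<dots> \<in> vec.span ?R" by (intro vec.span_scale vec.span_base rangeI)
      finally show ?thesis .
    qed (simp add: w_def adj_coeff_eq_0 vec.span_zero)
    then show "range w \<subseteq> vec.span ?R" by auto
  qed
  then have "vec.dim ?R = vec.dim (range w)" by (rule vec.span_eq_dim)
  finally show ?thesis by (simp add: w_def[abs_def])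
qed

theorem proposition1p7:
  fixes A :: "complex^('n::{finite,linorder})^('n::{finite,linorder})"
  assumes "CARD('n) \<ge> 2"
  shows "map_rank (frechet_derivative char_coeffs (at A)) = degree (min_polynomial A)"
proof -
  have "map_rank (frechet_derivative char_coeffs (at A)) = vec.dim (range (flat_power A))"
    unfolding map_rank_char_coeffs
    by (rule vec.span_eq_dim[OF span_adj_coeff_eq_span_power])
  \<comment> \<open>The powers form the orbit of the identity under \<open>left_mult A\<close>, and
    both sides reduce to the same \<open>LEAST\<close>.\<close>
  also have "\<dots> = degree (min_polynomial A)"
    unfolding degree_min_polynomial
    by (rule dim_orbit[of "left_mult A"]) (rule linear_left_mult flat_power_Suc)+
  finally show ?thesis .
qed

end
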